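(* Let $\mathcal{C}$ be a finitely complete category that has coequalizers and in which regular epimorphisms are closed under composition, let $H\colon\mathcal{C}\to\mathcal{C}$ preserve monomorphisms, let $\xi\colon X\to HX$ be an $H$-coalgebra, and let a $\mathsf{select}$ routine be given. Let $P_i$, $Q_i$ be the kernels on $X$ computed by the categorical partition refinement algorithm. If $P_i=Q_i$ for some $i$, then $\xi/Q_i\colon X/Q_i\to H(X/Q_i)$ is a simple coalgebra.
   Context: The kernel $\ker f$ of $f\colon X\to Y$ is its kernel pair $\ker f\rightrightarrows X$, regarded as a subobject of $X\times X$; a kernel on $X$ is the kernel of some morphism with domain $X$. For a kernel $R\rightrightarrows X$, $\kappa_R\colon X\twoheadrightarrow X/R$ is its coequalizer. $R$ is finer than $R'$ if $R\le R'$ as subobjects of $X\times X$; $\cap$ is intersection of subobjects. Equality of kernels means equality as subobjects. A $\mathsf{select}$ routine is an operation that receives a chain of regular epimorphisms $X\xrightarrow{y}Y\xrightarrow{z}Z$ and returns some morphism $\mathsf{select}(y,z)\colon Y\to K$ (for some object $K$). Algorithm (categorical partition refinement): given $\xi\colon X\to HX$, put $Q_0=X\times X$, $\bar q_0=\,!\colon X\to 1=K_0$, $P_0=\ker(X\xrightarrow{\xi}HX\xrightarrow{H!}H1)$. Then for $i=0,1,2,\dots$ (while $P_i$ is properly finer than $Q_i$) put: (1) $q_{i+1}=\mathsf{select}(\kappa_{P_i},f_i)\cdot\kappa_{P_i}\colon X\to K_{i+1}$, where $f_i\colon X/P_i\twoheadrightarrow X/Q_i$ is the unique morphism with $f_i\cdot\kappa_{P_i}=\kappa_{Q_i}$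 (it exists because $P_i$ is always finer than $Q_i$), and $\bar q_{i+1}=\langle\bar q_i,q_{i+1}\rangle\colon X\to\prod_{j\le i+1}K_j$; (2) $Q_{i+1}=\ker\bar q_{i+1}=Q_i\cap\ker q_{i+1}$; (3) $P_{i+1}=\ker(X\xrightarrow{\xi}HX\xrightarrow{H\bar q_{i+1}}H\prod_{j\le i+1}K_j)$. The morphism $\xi/Q_i\colon X/P_i\to H(X/Q_i)$ is the unique morphism with $(\xi/Q_i)\cdot\kappa_{P_i}=H\kappa_{Q_i}\cdot\xi$ (which exists for all $i$); when $P_i=Q_i$ it is a coalgebra structure on $X/Q_i$. A coalgebra morphism $h\colon(X,\xi)\to(Y,\zeta)$ is a morphism with $\zeta\cdot h=Hh\cdot\xi$. A quotient of a coalgebra is a coalgebra morphism carried by a regular epimorphism of $\mathcal{C}$; a coalgebra is simple if every quotient of it is an isomorphism. *)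

theory Defs
  imports Main
begin

record ('o, 'a) precat =
  Obj :: "'o set"
  Arr :: "'a set"
  Dom :: "'a \<Rightarrow> 'o"
  Cod :: "'a \<Rightarrow> 'o"
  Id :: "'o \<Rightarrow> 'a"
  Comp :: "'a \<Rightarrow> 'a \<Rightarrow> 'a"  (infixr \<open>\<cdot>\<index>\<close> 70)

definition hom :: "('o, 'a, 'z) precat_scheme \<Rightarrow> 'o \<Rightarrow> 'o \<Rightarrow> 'a set" where
  "hom C A B = {f \<in> Arr C. Dom C f = A \<and> Cod C f = B}"

text \<open>As usual in HOL, \<^const>\<open>Comp\<close> is a total function, which is meaningful only on
  composable pairs of arrows; \<open>g \<cdot>\<^bsub>C\<^esub> f\<close> means \<open>g\<close> after \<open>f\<close>.\<close>

definition category :: "('o, 'a) precat \<Rightarrow> bool" where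
  "category C \<longleftrightarrow>
     (\<forall>f \<in> Arr C. Dom C f \<in> Obj C \<and> Cod C f \<in> Obj C) \<and>
     (\<forall>A \<in> Obj C. Id C A \<in> hom C A A) \<and>
     (\<forall>f \<in> Arr C. \<forall>g \<in> Arr C. Dom C g = Cod C f \<longrightarrow> g \<cdot>\<^bsub>C\<^esub> f \<in> hom C (Dom C f) (Cod C g)) \<and>
     (\<forall>f \<in> Arr C. f \<cdot>\<^bsub>C\<^esub> Id C (Dom C f) = f \<and> Id C (Cod C f) \<cdot>\<^bsub>C\<^esub> f = f) \<and>
     (\<forall>f \<in> Arr C. \<forall>g \<in> Arr C. \<forall>h \<in> Arr C. Dom C g = Cod C f \<longrightarrow> Dom C h = Cod C g \<longrightarrow>
        (h \<cdot>\<^bsub>C\<^esub> g) \<cdot>\<^bsub>C\<^esub> f = h \<cdot>\<^bsub>C\<^esub> (g \<cdot>\<^bsub>C\<^esub> f))"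

record ('o, 'a, 'p, 'b) prefunctor =
  FObj :: "'o \<Rightarrow> 'p"
  FArr :: "'a \<Rightarrow> 'b"

definition is_functor :: "('o, 'a) precat \<Rightarrow> ('p, 'b) precat \<Rightarrow> ('o, 'a, 'p, 'b) prefunctor \<Rightarrow> bool" where
  "is_functor C D F \<longleftrightarrow>
     (\<forall>A \<in> Obj C. FObj F A \<in> Obj D \<and> FArr F (Id C A) = Id D (FObj F A)) \<and>
     (\<forall>f \<in> Arr C. FArr F f \<in> hom D (FObj F (Dom C f)) (FObj F (Cod C f))) \<and>
     (\<forall>f \<in> Arr C. \<forall>g \<in> Arr C. Dom C g = Cod C f \<longrightarrow>
        FArr F (g \<cdot>\<^bsub>C\<^esub> f) = FArr F g \<cdot>\<^bsub>D\<^esub> FArr F f)"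

definition mono_arr :: "('o, 'a) precat \<Rightarrow> 'a \<Rightarrow> bool" where
  "mono_arr C m \<longleftrightarrow> m \<in> Arr C \<and>
     (\<forall>A. \<forall>f \<in> hom C A (Dom C m). \<forall>g \<in> hom C A (Dom C m). m \<cdot>\<^bsub>C\<^esub> f = m \<cdot>\<^bsub>C\<^esub> g \<longrightarrow> f = g)"

definition iso_arr :: "('o, 'a) precat \<Rightarrow> 'a \<Rightarrow> bool" where
  "iso_arr C f \<longleftrightarrow> f \<in> Arr C \<and>
     (\<exists>g \<in> hom C (Cod C f) (Dom C f). g \<cdot>\<^bsub>C\<^esub> f = Id C (Dom C f) \<and> f \<cdot>\<^bsub>C\<^esub> g = Id C (Cod C f))"

definition preserves_monos :: "('o, 'a) precat \<Rightarrow> ('p, 'b) precat \<Rightarrow> ('o, 'a, 'p, 'b) prefunctor \<Rightarrow> bool" where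
  "preserves_monos C D F \<longleftrightarrow> (\<forall>m. mono_arr C m \<longrightarrow> mono_arr D (FArr F m))"

definition is_cone :: "('j, 'k) precat \<Rightarrow> ('o, 'a) precat \<Rightarrow> ('j, 'k, 'o, 'a) prefunctor \<Rightarrow>
    'o \<Rightarrow> ('j \<Rightarrow> 'a) \<Rightarrow> bool" where
  "is_cone J C D L l \<longleftrightarrow> L \<in> Obj C \<and>
     (\<forall>j \<in> Obj J. l j \<in> hom C L (FObj D j)) \<and>
     (\<forall>u \<in> Arr J. FArr D u \<cdot>\<^bsub>C\<^esub> l (Dom J u) = l (Cod J u))"

definition is_limit :: "('j, 'k) precat \<Rightarrow> ('o, 'a) precat \<Rightarrow> ('j, 'k, 'o, 'a) prefunctor \<Rightarrow>
    'o \<Rightarrow> ('j \<Rightarrow> 'a) \<Rightarrow> bool" where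
  "is_limit J C D L l \<longleftrightarrow> is_cone J C D L l \<and>
     (\<forall>M m. is_cone J C D M m \<longrightarrow> (\<exists>!h. h \<in> hom C M L \<and> (\<forall>j \<in> Obj J. l j \<cdot>\<^bsub>C\<^esub> h = m j)))"

text \<open>Every finite category is isomorphic to one whose objects and arrows are natural numbers.\<close>

definition finitely_complete :: "('o, 'a) precat \<Rightarrow> bool" where
  "finitely_complete C \<longleftrightarrow>
     (\<forall>(J :: (nat, nat) precat) D. category J \<and> finite (Obj J) \<and> finite (Arr J) \<and> is_functor J C D \<longrightarrow>
        (\<exists>L l. is_limit J C D L l))"

definition is_terminal :: "('o, 'a) precat \<Rightarrow> 'o \<Rightarrow> bool" where
  "is_terminal C T \<longleftrightarrow> T \<in> Obj C \<and> (\<forall>A \<in> Obj C. \<exists>!h. h \<in> hom C A T)"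

definition is_product :: "('o, 'a) precat \<Rightarrow> 'o \<Rightarrow> 'o \<Rightarrow> 'o \<times> 'a \<times> 'a \<Rightarrow> bool" where
  "is_product C A B = (\<lambda>(P, p, q). P \<in> Obj C \<and> p \<in> hom C P A \<and> q \<in> hom C P B \<and>
     (\<forall>Z. \<forall>f \<in> hom C Z A. \<forall>g \<in> hom C Z B. \<exists>!h. h \<in> hom C Z P \<and> p \<cdot>\<^bsub>C\<^esub> h = f \<and> q \<cdot>\<^bsub>C\<^esub> h = g))"

definition is_kernel_pair :: "('o, 'a) precat \<Rightarrow> 'a \<Rightarrow> 'a \<times> 'a \<Rightarrow> bool" where
  "is_kernel_pair C f = (\<lambda>(r, s). f \<in> Arr C \<and>
     r \<in> hom C (Dom C r) (Dom C f) \<and> s \<in> hom C (Dom C r) (Dom C f) \<and> f \<cdot>\<^bsub>C\<^esub> r = f \<cdot>\<^bsub>C\<^esub> s \<and>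
     (\<forall>Z. \<forall>a \<in> hom C Z (Dom C f). \<forall>b \<in> hom C Z (Dom C f). f \<cdot>\<^bsub>C\<^esub> a = f \<cdot>\<^bsub>C\<^esub> b \<longrightarrow>
        (\<exists>!h. h \<in> hom C Z (Dom C r) \<and> r \<cdot>\<^bsub>C\<^esub> h = a \<and> s \<cdot>\<^bsub>C\<^esub> h = b)))"

definition is_coequalizer :: "('o, 'a) precat \<Rightarrow> 'a \<times> 'a \<Rightarrow> 'a \<Rightarrow> bool" where
  "is_coequalizer C = (\<lambda>(f, g) c. f \<in> Arr C \<and> g \<in> hom C (Dom C f) (Cod C f) \<and>
     c \<in> hom C (Cod C f) (Cod C c) \<and> c \<cdot>\<^bsub>C\<^esub> f = c \<cdot>\<^bsub>C\<^esub> g \<and>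
     (\<forall>Z. \<forall>h \<in> hom C (Cod C f) Z. h \<cdot>\<^bsub>C\<^esub> f = h \<cdot>\<^bsub>C\<^esub> g \<longrightarrow>
        (\<exists>!k. k \<in> hom C (Cod C c) Z \<and> k \<cdot>\<^bsub>C\<^esub> c = h)))"

definition has_coequalizers :: "('o, 'a) precat \<Rightarrow> bool" where
  "has_coequalizers C \<longleftrightarrow>
     (\<forall>A B. \<forall>f \<in> hom C A B. \<forall>g \<in> hom C A B. \<exists>c. is_coequalizer C (f, g) c)"

definition regular_epi :: "('o, 'a) precat \<Rightarrow> 'a \<Rightarrow> bool" where
  "regular_epi C e \<longleftrightarrow> (\<exists>f g. is_coequalizer C (f, g) e)"

definition regular_epis_compose :: "('o, 'a) precat \<Rightarrow> bool" where
  "regular_epis_compose C \<longleftrightarrow>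
     (\<forall>d e. regular_epi C d \<and> regular_epi C e \<and> Dom C e = Cod C d \<longrightarrow> regular_epi C (e \<cdot>\<^bsub>C\<^esub> d))"

definition terminal_obj :: "('o, 'a) precat \<Rightarrow> 'o" where
  "terminal_obj C = (SOME T. is_terminal C T)"

definition bang :: "('o, 'a) precat \<Rightarrow> 'o \<Rightarrow> 'a" where
  "bang C A = (THE h. h \<in> hom C A (terminal_obj C))"

definition product :: "('o, 'a) precat \<Rightarrow> 'o \<Rightarrow> 'o \<Rightarrow> 'o \<times> 'a \<times> 'a" where
  "product C A B = (SOME p. is_product C A B p)"

definition prod_obj :: "('o, 'a) precat \<Rightarrow> 'o \<Rightarrow> 'o \<Rightarrow> 'o" where
  "prod_obj C A B = fst (product C A B)"

definition proj1 :: "('o, 'a) precat \<Rightarrow> 'o \<Rightarrow> 'o \<Rightarrow> 'a" where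
  "proj1 C A B = fst (snd (product C A B))"

definition proj2 :: "('o, 'a) precat \<Rightarrow> 'o \<Rightarrow> 'o \<Rightarrow> 'a" where
  "proj2 C A B = snd (snd (product C A B))"

definition pairing :: "('o, 'a) precat \<Rightarrow> 'a \<Rightarrow> 'a \<Rightarrow> 'a" where
  "pairing C f g = (THE h. h \<in> hom C (Dom C f) (prod_obj C (Cod C f) (Cod C g)) \<and>
     proj1 C (Cod C f) (Cod C g) \<cdot>\<^bsub>C\<^esub> h = f \<and> proj2 C (Cod C f) (Cod C g) \<cdot>\<^bsub>C\<^esub> h = g)"

definition kernel :: "('o, 'a) precat \<Rightarrow> 'a \<Rightarrow> 'a \<times> 'a" where
  "kernel C f = (SOME R. is_kernel_pair C f R)"

text \<open>Subobjects are represented by monomorphisms; a kernel \<open>(r, s)\<close> on \<open>X\<close> is the subobject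
  \<open>\<langle>r, s\<rangle>\<close> of \<open>X \<times> X\<close>, and equality of subobjects is containment both ways.\<close>

definition sub_le :: "('o, 'a) precat \<Rightarrow> 'a \<Rightarrow> 'a \<Rightarrow> bool" where
  "sub_le C m n \<longleftrightarrow> (\<exists>u \<in> hom C (Dom C m) (Dom C n). n \<cdot>\<^bsub>C\<^esub> u = m)"

definition finer :: "('o, 'a) precat \<Rightarrow> 'a \<times> 'a \<Rightarrow> 'a \<times> 'a \<Rightarrow> bool" where
  "finer C R S \<longleftrightarrow> sub_le C (pairing C (fst R) (snd R)) (pairing C (fst S) (snd S))"

definition kernel_eq :: "('o, 'a) precat \<Rightarrow> 'a \<times> 'a \<Rightarrow> 'a \<times> 'a \<Rightarrow> bool" where
  "kernel_eq C R S \<longleftrightarrow> finer C R S \<and> finer C S R"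

text \<open>Kernels that are equal as subobjects have the same coequalizers, so that the choice below
  gives them the same \<open>\<kappa>\<close> and hence the same quotient object.\<close>

definition \<kappa> :: "('o, 'a) precat \<Rightarrow> 'a \<times> 'a \<Rightarrow> 'a" where
  "\<kappa> C R = (SOME c. is_coequalizer C R c)"

definition quot :: "('o, 'a) precat \<Rightarrow> 'a \<times> 'a \<Rightarrow> 'o" where
  "quot C R = Cod C (\<kappa> C R)"

definition quot_map :: "('o, 'a) precat \<Rightarrow> 'a \<times> 'a \<Rightarrow> 'a \<times> 'a \<Rightarrow> 'a" where
  "quot_map C R S = (THE f. f \<in> hom C (quot C R) (quot C S) \<and> f \<cdot>\<^bsub>C\<^esub> \<kappa> C R = \<kappa> C S)"

definition coalgebra :: "('o, 'a) precat \<Rightarrow> ('o, 'a, 'o, 'a) prefunctor \<Rightarrow> 'o \<Rightarrow> 'a \<Rightarrow> bool" where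
  "coalgebra C H X \<xi> \<longleftrightarrow> X \<in> Obj C \<and> \<xi> \<in> hom C X (FObj H X)"

definition coalgebra_morphism :: "('o, 'a) precat \<Rightarrow> ('o, 'a, 'o, 'a) prefunctor \<Rightarrow>
    'o \<Rightarrow> 'a \<Rightarrow> 'o \<Rightarrow> 'a \<Rightarrow> 'a \<Rightarrow> bool" where
  "coalgebra_morphism C H X \<xi> Y \<zeta> h \<longleftrightarrow> coalgebra C H X \<xi> \<and> coalgebra C H Y \<zeta> \<and>
     h \<in> hom C X Y \<and> \<zeta> \<cdot>\<^bsub>C\<^esub> h = FArr H h \<cdot>\<^bsub>C\<^esub> \<xi>"

definition coalgebra_quotient :: "('o, 'a) precat \<Rightarrow> ('o, 'a, 'o, 'a) prefunctor \<Rightarrow>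
    'o \<Rightarrow> 'a \<Rightarrow> 'o \<Rightarrow> 'a \<Rightarrow> 'a \<Rightarrow> bool" where
  "coalgebra_quotient C H X \<xi> Y \<zeta> h \<longleftrightarrow> coalgebra_morphism C H X \<xi> Y \<zeta> h \<and> regular_epi C h"

definition coalgebra_iso :: "('o, 'a) precat \<Rightarrow> ('o, 'a, 'o, 'a) prefunctor \<Rightarrow>
    'o \<Rightarrow> 'a \<Rightarrow> 'o \<Rightarrow> 'a \<Rightarrow> 'a \<Rightarrow> bool" where
  "coalgebra_iso C H X \<xi> Y \<zeta> h \<longleftrightarrow> coalgebra_morphism C H X \<xi> Y \<zeta> h \<and>
     (\<exists>g. coalgebra_morphism C H Y \<zeta> X \<xi> g \<and> g \<cdot>\<^bsub>C\<^esub> h = Id C X \<and> h \<cdot>\<^bsub>C\<^esub> g = Id C Y)"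

definition simple_coalgebra :: "('o, 'a) precat \<Rightarrow> ('o, 'a, 'o, 'a) prefunctor \<Rightarrow> 'o \<Rightarrow> 'a \<Rightarrow> bool" where
  "simple_coalgebra C H X \<xi> \<longleftrightarrow> coalgebra C H X \<xi> \<and>
     (\<forall>Y \<zeta> h. coalgebra_quotient C H X \<xi> Y \<zeta> h \<longrightarrow> coalgebra_iso C H X \<xi> Y \<zeta> h)"

definition select_routine :: "('o, 'a) precat \<Rightarrow> ('a \<Rightarrow> 'a \<Rightarrow> 'a) \<Rightarrow> bool" where
  "select_routine C select \<longleftrightarrow>
     (\<forall>y z. regular_epi C y \<and> regular_epi C z \<and> Dom C z = Cod C y \<longrightarrow>
        select y z \<in> Arr C \<and> Dom C (select y z) = Cod C y)"

text \<open>The \<open>i\<close>-th state consists of \<open>q\<^sub>i\<close> bar, \<open>P\<^sub>i\<close> and \<open>Q\<^sub>i\<close>.  The product of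
  \<open>K\<^sub>0, \<dots>, K\<^sub>i\<^sub>+\<^sub>1\<close> is formed as the binary product of that of \<open>K\<^sub>0, \<dots>, K\<^sub>i\<close> with \<open>K\<^sub>i\<^sub>+\<^sub>1\<close>.
  The recursion is not stopped when \<open>P\<^sub>i\<close> and \<open>Q\<^sub>i\<close> agree; up to that point the states are those
  of the loop with the exit condition.\<close>

primrec refinement :: "('o, 'a) precat \<Rightarrow> ('o, 'a, 'o, 'a) prefunctor \<Rightarrow> 'o \<Rightarrow> 'a \<Rightarrow>
    ('a \<Rightarrow> 'a \<Rightarrow> 'a) \<Rightarrow> nat \<Rightarrow> 'a \<times> ('a \<times> 'a) \<times> ('a \<times> 'a)" where
  "refinement C H X \<xi> select 0 =
     (bang C X, kernel C (FArr H (bang C X) \<cdot>\<^bsub>C\<^esub> \<xi>), (proj1 C X X, proj2 C X X))"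
| "refinement C H X \<xi> select (Suc i) =
     (let (q_bar, P, Q) = refinement C H X \<xi> select i;
          q = select (\<kappa> C P) (quot_map C P Q) \<cdot>\<^bsub>C\<^esub> \<kappa> C P;
          q_bar' = pairing C q_bar q
      in (q_bar', kernel C (FArr H q_bar' \<cdot>\<^bsub>C\<^esub> \<xi>), kernel C q_bar'))"

definition refinement_P :: "('o, 'a) precat \<Rightarrow> ('o, 'a, 'o, 'a) prefunctor \<Rightarrow> 'o \<Rightarrow> 'a \<Rightarrow>
    ('a \<Rightarrow> 'a \<Rightarrow> 'a) \<Rightarrow> nat \<Rightarrow> 'a \<times> 'a" where
  "refinement_P C H X \<xi> select i = fst (snd (refinement C H X \<xi> select i))"

definition refinement_Q :: "('o, 'a) precat \<Rightarrow> ('o, 'a, 'o, 'a) prefunctor \<Rightarrow> 'o \<Rightarrow> 'a \<Rightarrow>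
    ('a \<Rightarrow> 'a \<Rightarrow> 'a) \<Rightarrow> nat \<Rightarrow> 'a \<times> 'a" where
  "refinement_Q C H X \<xi> select i = snd (snd (refinement C H X \<xi> select i))"

definition quot_struct :: "('o, 'a) precat \<Rightarrow> ('o, 'a, 'o, 'a) prefunctor \<Rightarrow> 'o \<Rightarrow> 'a \<Rightarrow>
    'a \<times> 'a \<Rightarrow> 'a \<times> 'a \<Rightarrow> 'a" where
  "quot_struct C H X \<xi> P Q = (THE h. h \<in> hom C (quot C P) (FObj H (quot C Q)) \<and>
     h \<cdot>\<^bsub>C\<^esub> \<kappa> C P = FArr H (\<kappa> C Q) \<cdot>\<^bsub>C\<^esub> \<xi>)"

end

theory Submission
  imports Defs
begin

text \<open>A coalgebra quotient \<open>h\<close> of \<open>X/Q\<^sub>i\<close> gives a regular epimorphism \<open>e = h \<cdot> \<kappa>\<close> that is a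
  coalgebra morphism on \<open>X\<close>.  By induction on \<open>j\<close>, the morphism \<open>q\<^sub>j\<close> bar identifies everything that
  \<open>e\<close> does: then \<open>q\<^sub>j\<close> bar factors through \<open>e\<close>, hence so does \<open>H q\<^sub>j \<cdot> \<xi>\<close> since \<open>H e \<cdot> \<xi> = \<zeta> \<cdot> e\<close>;
  so \<open>ker e\<close> is finer than \<open>P\<^sub>j\<close>, and therefore finer than \<open>Q\<^sub>j\<^sub>+\<^sub>1\<close>, which is coarser than \<open>P\<^sub>j\<close>.
  Thus \<open>\<kappa>\<close> factors through \<open>e\<close>, which makes \<open>h\<close> a split monomorphism, and a regular epimorphism,
  so an isomorphism.  The coalgebra structure \<open>\<xi>/Q\<^sub>i\<close> itself exists because the image factorization
  \<open>X \<rightarrow> X/Q\<^sub>i \<rightarrow> K\<close> of \<open>q\<^sub>i\<close> bar has a monic second part, which \<open>H\<close> preserves.\<close>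

section \<open>Categories and containment of kernels\<close>

locale cat =
  fixes C :: "('o, 'a) precat" (structure)
  assumes category: "category C"
begin

lemma homD: "f \<in> hom C A B \<Longrightarrow> f \<in> Arr C \<and> Dom C f = A \<and> Cod C f = B \<and> A \<in> Obj C \<and> B \<in> Obj C"
  using category unfolding category_def hom_def by auto

lemma comp_hom [intro]: "f \<in> hom C A B \<Longrightarrow> g \<in> hom C B D \<Longrightarrow> g \<cdot> f \<in> hom C A D"
  using category unfolding category_def hom_def by auto

lemma comp_assoc:
  "f \<in> hom C A B \<Longrightarrow> g \<in> hom C B D \<Longrightarrow> h \<in> hom C D E \<Longrightarrow> (h \<cdot> g) \<cdot> f = h \<cdot> (g \<cdot> f)"
  using category unfolding category_def hom_def by auto

lemma id_hom [intro]: "A \<in> Obj C \<Longrightarrow> Id C A \<in> hom C A A"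
  using category unfolding category_def by auto

lemma comp_id: "f \<in> hom C A B \<Longrightarrow> f \<cdot> Id C A = f"
  and id_comp: "f \<in> hom C A B \<Longrightarrow> Id C B \<cdot> f = f"
  using category unfolding category_def hom_def by auto

text \<open>For \<open>f\<close> and \<open>g\<close> with a common domain this is containment of
  \<open>ker f\<close> in \<open>ker g\<close>, tested on generalized elements. No kernel pairs or
  mediating morphisms have to be chosen, and containments compose like implications.\<close>

definition ker_le :: "'a \<Rightarrow> 'a \<Rightarrow> bool" where
  "ker_le f g \<longleftrightarrow> (\<forall>Z. \<forall>a \<in> hom C Z (Dom C f). \<forall>b \<in> hom C Z (Dom C f). f \<cdot> a = f \<cdot> b \<longrightarrow> g \<cdot> a = g \<cdot> b)"

lemma ker_leD:
  assumes "ker_le f g" "f \<in> hom C X Y" "a \<in> hom C Z X" "b \<in> hom C Z X" "f \<cdot> a = f \<cdot> b"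
  shows "g \<cdot> a = g \<cdot> b"
proof -
  have X: "Dom C f = X" using homD[OF assms(2)] by simp
  show ?thesis using assms(1,3-5) unfolding ker_le_def X by blast
qed

lemma ker_leI:
  assumes "f \<in> hom C X Y"
    and "\<And>Z a b. a \<in> hom C Z X \<Longrightarrow> b \<in> hom C Z X \<Longrightarrow> f \<cdot> a = f \<cdot> b \<Longrightarrow> g \<cdot> a = g \<cdot> b"
  shows "ker_le f g"
proof -
  have X: "Dom C f = X" using homD[OF assms(1)] by simp
  show ?thesis using assms(2) unfolding ker_le_def X by (intro allI ballI impI)
qed

lemma ker_le_comp:
  assumes "f \<in> hom C X Y" "g \<in> hom C Y Z" shows "ker_le f (g \<cdot> f)"
  using assms by (intro ker_leI[OF assms(1)]) (simp add: comp_assoc)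

lemma ker_le_trans:
  assumes f: "f \<in> hom C X Y" and g: "g \<in> hom C X Z" and "ker_le f g" "ker_le g h"
  shows "ker_le f h"
  by (rule ker_leI[OF f]) (rule ker_leD[OF assms(4) g _ _ ker_leD[OF assms(3) f]])

lemma mono_arrD:
  assumes "mono_arr C m" "m \<in> hom C A B" "a \<in> hom C Z A" "b \<in> hom C Z A" "m \<cdot> a = m \<cdot> b"
  shows "a = b"
proof -
  have A: "Dom C m = A" using homD[OF assms(2)] by simp
  show ?thesis using assms(1,3-5) unfolding mono_arr_def A by blast
qed

section \<open>Regular epimorphisms\<close>

lemma coequalizerD:
  assumes c: "is_coequalizer C (r, s) e" and e: "e \<in> hom C A B"
  shows "r \<in> hom C (Dom C r) A" "s \<in> hom C (Dom C r) A" "e \<cdot> r = e \<cdot> s"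
    and "\<And>Z h. h \<in> hom C A Z \<Longrightarrow> h \<cdot> r = h \<cdot> s \<Longrightarrow> \<exists>!k. k \<in> hom C B Z \<and> k \<cdot> e = h"
proof -
  have c': "s \<in> hom C (Dom C r) (Cod C r)" "e \<in> hom C (Cod C r) (Cod C e)" "r \<in> Arr C"
    "e \<cdot> r = e \<cdot> s"
    "\<forall>Z. \<forall>h \<in> hom C (Cod C r) Z. h \<cdot> r = h \<cdot> s \<longrightarrow> (\<exists>!k. k \<in> hom C (Cod C e) Z \<and> k \<cdot> e = h)"
    using c unfolding is_coequalizer_def prod.case by - (elim conjE, assumption)+
  have A: "Cod C r = A" "Cod C e = B" using homD[OF c'(2)] homD[OF e] by simp_all
  show "r \<in> hom C (Dom C r) A" "s \<in> hom C (Dom C r) A" "e \<cdot> r = e \<cdot> s"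
    using c'(1,3,4) A by (simp_all add: hom_def)
  show "\<And>Z h. h \<in> hom C A Z \<Longrightarrow> h \<cdot> r = h \<cdot> s \<Longrightarrow> \<exists>!k. k \<in> hom C B Z \<and> k \<cdot> e = h"
    using c'(5) A by simp
qed

text \<open>\<open>e\<close> is a coequalizer of some pair \<open>r\<close>, \<open>s\<close>. As
  \<open>e\<close> identifies this pair, so does \<open>g\<close>, and the universal property
  applies.\<close>

lemma regular_epi_factor:
  assumes "regular_epi C e" "e \<in> hom C A B" "g \<in> hom C A D" "ker_le e g"
  obtains k where "k \<in> hom C B D" "k \<cdot> e = g"
proof -
  obtain r s where c: "is_coequalizer C (r, s) e" using assms(1) unfolding regular_epi_def by blast
  note c = coequalizerD[OF c assms(2)]
  have "g \<cdot> r = g \<cdot> s" using ker_leD[OF assms(4,2) c(1,2,3)] .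
  from ex1_implies_ex[OF c(4)[OF assms(3) this]] that show thesis by (elim exE conjE)
qed

text \<open>This is the uniqueness half of the universal property: \<open>f\<close> and
  \<open>g\<close> both factor the same morphism through \<open>e\<close>.\<close>

lemma regular_epi_epi:
  assumes "regular_epi C e" and e: "e \<in> hom C A B"
    and fg: "f \<in> hom C B D" "g \<in> hom C B D" "f \<cdot> e = g \<cdot> e"
  shows "f = g"
proof -
  obtain r s where c: "is_coequalizer C (r, s) e" using assms(1) unfolding regular_epi_def by blast
  note c = coequalizerD[OF c e]
  have "(f \<cdot> e) \<cdot> r = (f \<cdot> e) \<cdot> s"
    using c(3) comp_assoc[OF c(1) e fg(1)] comp_assoc[OF c(2) e fg(1)] by simp
  from c(4)[OF comp_hom[OF e fg(1)] this] show ?thesis using fg by metis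
qed

text \<open>If \<open>f \<cdot> d\<close> is a coequalizer of \<open>r\<close>, \<open>s\<close>,
  then \<open>f\<close> is one of \<open>d \<cdot> r\<close>, \<open>d \<cdot> s\<close>.\<close>

lemma regular_epi_cancel:
  assumes d: "regular_epi C d" "d \<in> hom C A B" and f: "f \<in> hom C B D" and "regular_epi C (f \<cdot> d)"
  shows "regular_epi C f"
proof -
  obtain r s where c: "is_coequalizer C (r, s) (f \<cdot> d)" using assms(4) unfolding regular_epi_def by blast
  have fd: "f \<cdot> d \<in> hom C A D" using assms by blast
  note rs = coequalizerD[OF c fd]
  have drs: "d \<cdot> r \<in> hom C (Dom C r) B" "d \<cdot> s \<in> hom C (Dom C r) B" using rs d by auto
  have "is_coequalizer C (d \<cdot> r, d \<cdot> s) f"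
  proof -
    have 1: "f \<cdot> (d \<cdot> r) = f \<cdot> (d \<cdot> s)" using rs(3) comp_assoc[OF rs(1) d(2) f] comp_assoc[OF rs(2) d(2) f] by simp
    have 2: "\<exists>!k. k \<in> hom C D Z \<and> k \<cdot> f = h"
      if h: "h \<in> hom C B Z" "h \<cdot> (d \<cdot> r) = h \<cdot> (d \<cdot> s)" for Z h
    proof -
      have "(h \<cdot> d) \<cdot> r = (h \<cdot> d) \<cdot> s"
        using h(2) comp_assoc[OF rs(1) d(2) h(1)] comp_assoc[OF rs(2) d(2) h(1)] by simp
      then have ex: "\<exists>!k. k \<in> hom C D Z \<and> k \<cdot> (f \<cdot> d) = h \<cdot> d"
        using rs(4) comp_hom[OF d(2) h(1)] by blast
      \<comment> \<open>Since \<open>d\<close> is epic, the two equations have the same solutions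
        \<open>k\<close>, so existence and uniqueness transfer together.\<close>
      have "k \<cdot> f = h \<longleftrightarrow> k \<cdot> (f \<cdot> d) = h \<cdot> d" if "k \<in> hom C D Z" for k
        using regular_epi_epi[OF d comp_hom[OF f that] h(1)] comp_assoc[OF d(2) f that] by auto
      then show ?thesis using ex by blast
    qed
    show ?thesis using 1 2 drs[THEN homD] homD[OF f] drs f unfolding is_coequalizer_def by auto
  qed
  then show ?thesis unfolding regular_epi_def by blast
qed

section \<open>Kernel pairs\<close>

lemma kernel_pairD:
  assumes "is_kernel_pair C f R" "f \<in> hom C X Y"
  obtains r s where "R = (r, s)" "r \<in> hom C (Dom C r) X" "s \<in> hom C (Dom C r) X" "f \<cdot> r = f \<cdot> s"
    and "\<And>Z a b. a \<in> hom C Z X \<Longrightarrow> b \<in> hom C Z X \<Longrightarrow> f \<cdot> a = f \<cdot> b \<Longrightarrow>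
      \<exists>h \<in> hom C Z (Dom C r). r \<cdot> h = a \<and> s \<cdot> h = b"
proof -
  obtain r s where R: "R = (r, s)" by fastforce
  have X: "Dom C f = X" using assms(2) by (auto simp: hom_def)
  have k: "r \<in> hom C (Dom C r) X" "s \<in> hom C (Dom C r) X" "f \<cdot> r = f \<cdot> s"
    "\<forall>Z. \<forall>a \<in> hom C Z X. \<forall>b \<in> hom C Z X. f \<cdot> a = f \<cdot> b \<longrightarrow>
      (\<exists>!h. h \<in> hom C Z (Dom C r) \<and> r \<cdot> h = a \<and> s \<cdot> h = b)"
    using assms(1) unfolding R is_kernel_pair_def prod.case X by - (elim conjE, assumption)+
  show thesis
  proof (rule that[OF R k(1,2,3)])
    fix Z a b assume "a \<in> hom C Z X" "b \<in> hom C Z X" "f \<cdot> a = f \<cdot> b"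
    then have "\<exists>!h. h \<in> hom C Z (Dom C r) \<and> r \<cdot> h = a \<and> s \<cdot> h = b" using k(4) by simp
    then show "\<exists>h \<in> hom C Z (Dom C r). r \<cdot> h = a \<and> s \<cdot> h = b" by (elim ex1E) blast
  qed
qed

text \<open>Every pair identified by \<open>f\<close> factors through its kernel pair, so
  identifying \<open>r\<close> and \<open>s\<close> suffices.\<close>

lemma coequalizer_ker_le:
  assumes "is_kernel_pair C f (r, s)" "f \<in> hom C X Y" "g \<in> hom C X Z" "g \<cdot> r = g \<cdot> s"
  shows "ker_le f g"
proof (rule ker_leI[OF assms(2)])
  fix W a b assume ab: "a \<in> hom C W X" "b \<in> hom C W X" "f \<cdot> a = f \<cdot> b"
  from assms(1,2) obtain h where rs: "r \<in> hom C (Dom C r) X" "s \<in> hom C (Dom C r) X"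
    and h: "h \<in> hom C W (Dom C r)" "r \<cdot> h = a" "s \<cdot> h = b"
    by (rule kernel_pairD) (use ab in blast)
  show "g \<cdot> a = g \<cdot> b"
    using comp_assoc[OF h(1) rs(1) assms(3)] comp_assoc[OF h(1) rs(2) assms(3)] h(2,3) assms(4) by simp
qed

end

section \<open>Terminal object, binary products and kernel pairs as finite limits\<close>

locale complete_cat = cat C for C :: "('o, 'a) precat" (structure) +
  assumes finitely_complete: "finitely_complete C"
    and has_coequalizers: "has_coequalizers C"
    and regular_epis_compose: "regular_epis_compose C"
begin

lemma terminal_exists: "\<exists>T. is_terminal C T"
proof -
  define J :: "(nat, nat) precat" where
    \<comment> \<open>A cone over the empty diagram is just an object, so its limit is
      terminal.\<close>
    "J = \<lparr>Obj = {}, Arr = {}, Dom = id, Cod = id, Id = id, Comp = (\<lambda>g f. f)\<rparr>"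
  define D :: "(nat, nat, 'o, 'a) prefunctor" where "D = \<lparr>FObj = undefined, FArr = undefined\<rparr>"
  have "category J \<and> finite (Obj J) \<and> finite (Arr J) \<and> is_functor J C D"
    by (simp add: J_def category_def is_functor_def)
  then obtain L l where "is_limit J C D L l" using finitely_complete unfolding finitely_complete_def by blast
  then have "is_terminal C L" by (auto simp: is_limit_def is_cone_def is_terminal_def J_def)
  then show ?thesis by blast
qed

lemma product_exists:
  assumes "A \<in> Obj C" "B \<in> Obj C" shows "\<exists>p. is_product C A B p"
proof -
  define J :: "(nat, nat) precat" where
    \<comment> \<open>The discrete category on two objects, each object coding its own
      identity.\<close>
    "J = \<lparr>Obj = {0, 1}, Arr = {0, 1}, Dom = id, Cod = id, Id = id, Comp = (\<lambda>g f. f)\<rparr>"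
  define D :: "(nat, nat, 'o, 'a) prefunctor" where
    "D = \<lparr>FObj = (\<lambda>n. if n = 0 then A else B), FArr = (\<lambda>n. if n = 0 then Id C A else Id C B)\<rparr>"
  have J: "category J \<and> finite (Obj J) \<and> finite (Arr J)"
    by (auto simp: J_def category_def hom_def)
  have D: "is_functor J C D"
    using id_comp[OF id_hom] assms by (auto simp: J_def D_def is_functor_def)
  obtain L l where lim: "is_limit J C D L l"
    using J D finitely_complete unfolding finitely_complete_def by blast
  have "is_product C A B (L, l 0, l 1)"
    unfolding is_product_def prod.case
  proof (intro conjI allI ballI)
    show "L \<in> Obj C" "l 0 \<in> hom C L A" "l 1 \<in> hom C L B"
      using lim by (auto simp: is_limit_def is_cone_def J_def D_def)
    fix Z f g assume fg: "f \<in> hom C Z A" "g \<in> hom C Z B"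
    then have "is_cone J C D Z (\<lambda>n. if n = 0 then f else g)"
      using homD[OF fg(1)] by (auto simp: is_cone_def J_def D_def id_comp)
    then have "\<exists>!h. h \<in> hom C Z L \<and> (\<forall>j \<in> Obj J. l j \<cdot> h = (if j = 0 then f else g))"
      using lim unfolding is_limit_def by blast
    then show "\<exists>!h. h \<in> hom C Z L \<and> l 0 \<cdot> h = f \<and> l 1 \<cdot> h = g" by (simp add: J_def)
  qed
  then show ?thesis by blast
qed

lemma kernel_pair_exists:
  assumes "f \<in> hom C A B" shows "\<exists>R. is_kernel_pair C f R"
proof -
  note f = homD[OF assms]
  \<comment> \<open>The cospan shape: 0, 1, 2 are the objects and also their identities, 3 goes from
    0 to 2 and 4 from 1 to 2. Of two composable arrows at least one is an identity, and
    \<open>Comp\<close> returns the other one. The diagram \<open>D\<close> sends both 3 and 4 to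
    \<open>f\<close>, so its limit is the pullback of \<open>f\<close> along itself.\<close>
  define J :: "(nat, nat) precat" where
    "J = \<lparr>Obj = {0, 1, 2}, Arr = {0, 1, 2, 3, 4}, Dom = (\<lambda>n. if n = 3 then 0 else if n = 4 then 1 else n),
      Cod = (\<lambda>n. if n \<ge> 3 then 2 else n), Id = id, Comp = (\<lambda>v u. if u < 3 then v else u)\<rparr>"
  define D :: "(nat, nat, 'o, 'a) prefunctor" where
    "D = \<lparr>FObj = (\<lambda>n. if n < 2 then A else B),
      FArr = (\<lambda>n. if n < 2 then Id C A else if n = 2 then Id C B else f)\<rparr>"
  have J: "category J \<and> finite (Obj J) \<and> finite (Arr J)"
    by (auto simp: J_def category_def hom_def)
  have D: "is_functor J C D"
    using id_comp[OF id_hom] comp_id[OF assms] id_comp[OF assms] assms f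
    by (auto simp: J_def D_def is_functor_def)
  obtain L l where lim: "is_limit J C D L l"
    using J D finitely_complete unfolding finitely_complete_def by blast
  have l: "l 0 \<in> hom C L A" "l 1 \<in> hom C L A" "f \<cdot> l 0 = l 2" "f \<cdot> l 1 = l 2"
    using lim by (auto simp: is_limit_def is_cone_def J_def D_def)
  have "is_kernel_pair C f (l 0, l 1)"
    unfolding is_kernel_pair_def prod.case
  proof (intro conjI allI ballI impI)
    show "f \<in> Arr C" "l 0 \<in> hom C (Dom C (l 0)) (Dom C f)" "l 1 \<in> hom C (Dom C (l 0)) (Dom C f)"
      "f \<cdot> l 0 = f \<cdot> l 1"
      using l f homD[OF l(1)] by auto
    fix Z a b assume ab: "a \<in> hom C Z (Dom C f)" "b \<in> hom C Z (Dom C f)" "f \<cdot> a = f \<cdot> b"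
    have ab': "a \<in> hom C Z A" "b \<in> hom C Z A" using ab f by auto
    define m where "m = (\<lambda>n::nat. if n = 0 then a else if n = 1 then b else f \<cdot> a)"
    have "is_cone J C D Z m"
      using homD[OF ab'(1)] ab(3) ab' id_comp[OF ab'(1)] id_comp[OF ab'(2)]
        comp_hom[OF ab'(1) assms] id_comp[OF comp_hom[OF ab'(1) assms]]
      by (auto simp: is_cone_def J_def D_def m_def)
    then have "\<exists>!h. h \<in> hom C Z L \<and> (\<forall>j \<in> Obj J. l j \<cdot> h = m j)"
      using lim unfolding is_limit_def by blast
    \<comment> \<open>The condition on the leg at object 2 follows from the one at 0, because
      \<open>l 2\<close> is \<open>f \<cdot> l 0\<close> and \<open>m 2\<close> is
      \<open>f \<cdot> a\<close>.\<close>
    moreover have "(h \<in> hom C Z L \<and> (\<forall>j \<in> Obj J. l j \<cdot> h = m j)) =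
        (h \<in> hom C Z (Dom C (l 0)) \<and> l 0 \<cdot> h = a \<and> l 1 \<cdot> h = b)" for h
      using homD[OF l(1)] comp_assoc[OF _ l(1) assms, of h Z] l(3) by (auto simp: J_def m_def)
    ultimately show "\<exists>!h. h \<in> hom C Z (Dom C (l 0)) \<and> l 0 \<cdot> h = a \<and> l 1 \<cdot> h = b" by simp
  qed
  then show ?thesis by blast
qed

lemma bang_hom: "A \<in> Obj C \<Longrightarrow> bang C A \<in> hom C A (terminal_obj C)"
  and to_terminal_unique:
    "f \<in> hom C A (terminal_obj C) \<Longrightarrow> g \<in> hom C A (terminal_obj C) \<Longrightarrow> f = g"
proof -
  have t: "is_terminal C (terminal_obj C)"
    unfolding terminal_obj_def using terminal_exists by (rule someI_ex)
  show "bang C A \<in> hom C A (terminal_obj C)" if "A \<in> Obj C"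
    unfolding bang_def by (rule theI') (use t that in \<open>auto simp: is_terminal_def\<close>)
  show "f = g" if "f \<in> hom C A (terminal_obj C)" "g \<in> hom C A (terminal_obj C)"
    using t that homD[OF that(1)] unfolding is_terminal_def by blast
qed

lemma product_is_product:
  "A \<in> Obj C \<Longrightarrow> B \<in> Obj C \<Longrightarrow> is_product C A B (prod_obj C A B, proj1 C A B, proj2 C A B)"
  unfolding prod_obj_def proj1_def proj2_def product_def
  using someI_ex[OF product_exists] by auto

lemma proj_hom:
  assumes "A \<in> Obj C" "B \<in> Obj C"
  shows "proj1 C A B \<in> hom C (prod_obj C A B) A" "proj2 C A B \<in> hom C (prod_obj C A B) B"
  using product_is_product[OF assms] unfolding is_product_def by auto

lemma pairing:
  assumes "f \<in> hom C Z A" "g \<in> hom C Z B"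
  shows "pairing C f g \<in> hom C Z (prod_obj C A B)"
    and "proj1 C A B \<cdot> pairing C f g = f" and "proj2 C A B \<cdot> pairing C f g = g"
proof -
  have "is_product C A B (prod_obj C A B, proj1 C A B, proj2 C A B)"
    using product_is_product assms homD by blast
  then have "\<exists>!h. h \<in> hom C Z (prod_obj C A B) \<and> proj1 C A B \<cdot> h = f \<and> proj2 C A B \<cdot> h = g"
    using assms unfolding is_product_def prod.case by blast
  from theI'[OF this] show "pairing C f g \<in> hom C Z (prod_obj C A B)"
    "proj1 C A B \<cdot> pairing C f g = f" "proj2 C A B \<cdot> pairing C f g = g"
    unfolding pairing_def using homD[OF assms(1)] homD[OF assms(2)] by auto
qed

lemma pair_ext:
  assumes "a \<in> hom C Z (prod_obj C A B)" "b \<in> hom C Z (prod_obj C A B)" "A \<in> Obj C" "B \<in> Obj C"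
    and "proj1 C A B \<cdot> a = proj1 C A B \<cdot> b" "proj2 C A B \<cdot> a = proj2 C A B \<cdot> b"
  shows "a = b"
proof -
  note p = proj_hom[OF assms(3,4)]
  have "\<exists>!h. h \<in> hom C Z (prod_obj C A B) \<and> proj1 C A B \<cdot> h = proj1 C A B \<cdot> a \<and>
      proj2 C A B \<cdot> h = proj2 C A B \<cdot> a"
    using product_is_product[OF assms(3,4)] comp_hom[OF assms(1) p(1)] comp_hom[OF assms(1) p(2)]
    unfolding is_product_def prod.case by blast
  then show ?thesis using assms by metis
qed

text \<open>The kernel of a pairing is the intersection of the two kernels. The inclusion needed
  here holds because the projections are jointly monic.\<close>

lemma ker_le_pairing:
  assumes e: "e \<in> hom C X Y" and f: "f \<in> hom C X A" "ker_le e f" and g: "g \<in> hom C X B" "ker_le e g"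
  shows "ker_le e (pairing C f g)"
proof (rule ker_leI[OF e])
  fix Z a b assume ab: "a \<in> hom C Z X" "b \<in> hom C Z X" "e \<cdot> a = e \<cdot> b"
  have o: "A \<in> Obj C" "B \<in> Obj C" using f g homD by blast+
  note p = pairing[OF f(1) g(1)] and pr = proj_hom[OF o]
  show "pairing C f g \<cdot> a = pairing C f g \<cdot> b"
  proof (rule pair_ext[OF comp_hom[OF ab(1) p(1)] comp_hom[OF ab(2) p(1)] o])
    show "proj1 C A B \<cdot> (pairing C f g \<cdot> a) = proj1 C A B \<cdot> (pairing C f g \<cdot> b)"
      using ker_leD[OF f(2) e ab] comp_assoc[OF ab(1) p(1) pr(1)] comp_assoc[OF ab(2) p(1) pr(1)] p
      by simp
    show "proj2 C A B \<cdot> (pairing C f g \<cdot> a) = proj2 C A B \<cdot> (pairing C f g \<cdot> b)"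
      using ker_leD[OF g(2) e ab] comp_assoc[OF ab(1) p(1) pr(2)] comp_assoc[OF ab(2) p(1) pr(2)] p
      by simp
  qed
qed

section \<open>Quotients by kernels and image factorization\<close>

lemma kernel_is_kernel_pair: "f \<in> hom C A B \<Longrightarrow> is_kernel_pair C f (kernel C f)"
  unfolding kernel_def using kernel_pair_exists by (rule someI_ex)

text \<open>A morphism and the coequalizer of its kernel pair have the same kernel:
  \<open>\<kappa> C R\<close> identifies the kernel pair of \<open>f\<close>, and conversely
  \<open>f\<close> factors through \<open>\<kappa> C R\<close>. Later arguments can thus switch
  freely between the two.\<close>

lemma \<kappa>_kernel:
  assumes k: "is_kernel_pair C f R" and f: "f \<in> hom C X Y"
  shows "is_coequalizer C R (\<kappa> C R)" "regular_epi C (\<kappa> C R)" "\<kappa> C R \<in> hom C X (quot C R)"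
    and "ker_le f (\<kappa> C R)" "ker_le (\<kappa> C R) f"
proof -
  obtain r s where R: "R = (r, s)" "r \<in> hom C (Dom C r) X" "s \<in> hom C (Dom C r) X" "f \<cdot> r = f \<cdot> s"
    by (rule kernel_pairD[OF k f])
  have "\<exists>c. is_coequalizer C R c" using has_coequalizers R unfolding has_coequalizers_def by blast
  then show c: "is_coequalizer C R (\<kappa> C R)" unfolding \<kappa>_def by (rule someI_ex)
  then show "regular_epi C (\<kappa> C R)" unfolding regular_epi_def using R(1) by blast
  have X: "Cod C r = X" using homD[OF R(2)] by blast
  show h: "\<kappa> C R \<in> hom C X (quot C R)"
    using c X unfolding quot_def is_coequalizer_def by (auto simp: R(1))
  have "\<kappa> C R \<cdot> r = \<kappa> C R \<cdot> s"
    using coequalizerD(3)[OF c[unfolded R(1)] h[unfolded R(1)]] unfolding R(1) .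
  then show "ker_le f (\<kappa> C R)" using coequalizer_ker_le k f h unfolding R(1) by blast
  obtain g where "g \<in> hom C (quot C R) Y" "g \<cdot> \<kappa> C R = f"
    using coequalizerD(4)[OF c[unfolded R(1)] h[unfolded R(1)] f R(4)] unfolding R(1) by blast
  then show "ker_le (\<kappa> C R) f" using ker_le_comp[OF h] by blast
qed

text \<open>Let \<open>d\<close> be the quotient of \<open>B\<close> by the kernel of
  \<open>m\<close>. Closure of regular epimorphisms under composition makes
  \<open>d \<cdot> e\<close> regular epic. Since \<open>m\<close> factors through \<open>d\<close>,
  everything identified by \<open>d \<cdot> e\<close> is identified by \<open>m \<cdot> e\<close>,
  hence by \<open>e\<close>. So \<open>e\<close> factors through \<open>d \<cdot> e\<close>, which
  makes \<open>d\<close> a split monomorphism. Morphisms that \<open>m\<close> identifies are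
  identified by \<open>d\<close> and are therefore equal.\<close>

lemma image_mono:
  assumes e: "regular_epi C e" "e \<in> hom C A B" and m: "m \<in> hom C B D" and "ker_le (m \<cdot> e) e"
  shows "mono_arr C m"
proof -
  let ?d = "\<kappa> C (kernel C m)" and ?J = "quot C (kernel C m)"
  note d = \<kappa>_kernel[OF kernel_is_kernel_pair[OF m] m]
  obtain n where n: "n \<in> hom C ?J D" "n \<cdot> ?d = m"
    using regular_epi_factor[OF d(2,3) m d(5)] .
  have de: "?d \<cdot> e \<in> hom C A ?J" using e d by blast
  have "regular_epi C (?d \<cdot> e)"
    using regular_epis_compose e d homD[OF e(2)] homD[OF d(3)] unfolding regular_epis_compose_def by metis
  moreover have "ker_le (?d \<cdot> e) e"
    using ker_le_trans[OF de comp_hom[OF e(2) m] _ assms(4)] ker_le_comp[OF de n(1)]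
      comp_assoc[OF e(2) d(3) n(1)] n(2) by simp
  ultimately obtain k where k: "k \<in> hom C ?J B" "k \<cdot> (?d \<cdot> e) = e"
    using regular_epi_factor de e(2) by blast
  have o: "B \<in> Obj C" using homD[OF m] by blast
  have kd: "k \<cdot> ?d = Id C B"
    using regular_epi_epi[OF e comp_hom[OF d(3) k(1)] id_hom[OF o]] comp_assoc[OF e(2) d(3) k(1)]
      k(2) id_comp[OF e(2)] by simp
  show ?thesis unfolding mono_arr_def
  proof (intro conjI allI ballI impI)
    show "m \<in> Arr C" using homD[OF m] by blast
    fix Z a b assume "a \<in> hom C Z (Dom C m)" "b \<in> hom C Z (Dom C m)" and eq: "m \<cdot> a = m \<cdot> b"
    then have ab: "a \<in> hom C Z B" "b \<in> hom C Z B" using homD[OF m] by auto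
    have "?d \<cdot> a = ?d \<cdot> b" using ker_leD[OF d(4) m ab eq] .
    then have "(k \<cdot> ?d) \<cdot> a = (k \<cdot> ?d) \<cdot> b"
      using comp_assoc[OF ab(1) d(3) k(1)] comp_assoc[OF ab(2) d(3) k(1)] by simp
    then show "a = b" using kd id_comp ab by simp
  qed
qed

text \<open>The quotient map is the second factor of the regular epimorphism
  \<open>\<kappa> C Q\<close> through the regular epimorphism \<open>\<kappa> C P\<close>, so
  cancellation applies. This is what makes the arguments of \<open>select\<close> a chain of regular
  epimorphisms.\<close>

lemma quot_map_regular_epi:
  assumes P: "is_kernel_pair C f P" "f \<in> hom C X Y" and Q: "is_kernel_pair C g Q" "g \<in> hom C X Z"
    and "ker_le f g"
  shows "quot_map C P Q \<in> hom C (quot C P) (quot C Q)" "regular_epi C (quot_map C P Q)"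
proof -
  note p = \<kappa>_kernel[OF P] and q = \<kappa>_kernel[OF Q]
  have "ker_le (\<kappa> C P) (\<kappa> C Q)"
    using ker_le_trans[OF p(3) P(2) p(5) ker_le_trans[OF P(2) Q(2) assms(5) q(4)]] .
  then obtain k where k: "k \<in> hom C (quot C P) (quot C Q)" "k \<cdot> \<kappa> C P = \<kappa> C Q"
    using regular_epi_factor[OF p(2,3) q(3)] by blast
  have "quot_map C P Q = k"
    unfolding quot_map_def using k regular_epi_epi[OF p(2,3)] by (intro the_equality) auto
  then show "quot_map C P Q \<in> hom C (quot C P) (quot C Q)" "regular_epi C (quot_map C P Q)"
    using k regular_epi_cancel[OF p(2,3) k(1)] q(2) by auto
qed

text \<open>The morphism \<open>u\<close> witnessing the containment satisfies
  \<open>r' \<cdot> u = r\<close> and \<open>s' \<cdot> u = s\<close> after projecting, so the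
  equation for \<open>r'\<close>, \<open>s'\<close> can be precomposed with
  \<open>u\<close>.\<close>

lemma finer_coequalizes:
  assumes "finer C (r, s) (r', s')" and rs: "r \<in> hom C D X" "s \<in> hom C D X"
    and rs': "r' \<in> hom C D' X" "s' \<in> hom C D' X" and h: "h \<in> hom C X Z" "h \<cdot> r' = h \<cdot> s'"
  shows "h \<cdot> r = h \<cdot> s"
proof -
  note p = pairing[OF rs] and p' = pairing[OF rs']
  have o: "X \<in> Obj C" using homD[OF rs(1)] by blast
  obtain u where "u \<in> hom C (Dom C (pairing C r s)) (Dom C (pairing C r' s'))"
    and pu: "pairing C r' s' \<cdot> u = pairing C r s"
    using assms(1) unfolding finer_def sub_le_def by auto
  then have u: "u \<in> hom C D D'" using homD[OF p(1)] homD[OF p'(1)] by auto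
  have "r' \<cdot> u = r" "s' \<cdot> u = s"
    using comp_assoc[OF u p'(1) proj_hom(1)[OF o o]] comp_assoc[OF u p'(1) proj_hom(2)[OF o o]] p p' pu
    by auto
  then show ?thesis using comp_assoc[OF u rs'(1) h(1)] comp_assoc[OF u rs'(2) h(1)] h(2) by simp
qed

text \<open>Containment both ways gives the two pairs the same predicate of being a coequalizer, and
  \<open>SOME\<close> picks the same arrow from equal predicates. The quotient objects then coincide
  on the nose, with no isomorphism to transport along.\<close>

lemma kernel_eq_\<kappa>:
  assumes eq: "kernel_eq C P Q" and P: "is_kernel_pair C f P" "f \<in> hom C X Y"
    and Q: "is_kernel_pair C g Q" "g \<in> hom C X Z"
  shows "\<kappa> C P = \<kappa> C Q"
proof -
  obtain r s where p: "P = (r, s)" "r \<in> hom C (Dom C r) X" "s \<in> hom C (Dom C r) X"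
    by (rule kernel_pairD[OF P])
  obtain r' s' where q: "Q = (r', s')" "r' \<in> hom C (Dom C r') X" "s' \<in> hom C (Dom C r') X"
    by (rule kernel_pairD[OF Q])
  have iff: "h \<cdot> r = h \<cdot> s \<longleftrightarrow> h \<cdot> r' = h \<cdot> s'" if "h \<in> hom C X W" for h W
    using finer_coequalizes[OF _ p(2,3) q(2,3) that] finer_coequalizes[OF _ q(2,3) p(2,3) that] eq
    unfolding kernel_eq_def p(1) q(1) by blast
  have cod: "Cod C r = X" "Cod C r' = X" "r \<in> Arr C" "r' \<in> Arr C" using homD p(2) q(2) by simp_all
  have "is_coequalizer C P c \<longleftrightarrow> is_coequalizer C Q c" for c
    unfolding is_coequalizer_def p(1) q(1) prod.case cod(1,2)
    using cod(3,4) p(3) q(3) iff by (simp cong: conj_cong)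
  then have "is_coequalizer C P = is_coequalizer C Q" ..
  then show ?thesis unfolding \<kappa>_def by simp
qed

end

section \<open>The states of the refinement algorithm\<close>

locale refinement_algorithm = complete_cat C for C :: "('o, 'a) precat" (structure) +
  fixes H :: "('o, 'a, 'o, 'a) prefunctor" and X :: 'o and \<xi> :: 'a and select :: "'a \<Rightarrow> 'a \<Rightarrow> 'a"
  assumes is_functor: "is_functor C C H"
    and preserves_monos: "preserves_monos C C H"
    and coalgebra: "coalgebra C H X \<xi>"
    and select_routine: "select_routine C select"
begin

abbreviation q_bar :: "nat \<Rightarrow> 'a" where
  "q_bar i \<equiv> fst (refinement C H X \<xi> select i)"

abbreviation P :: "nat \<Rightarrow> 'a \<times> 'a" where
  "P i \<equiv> refinement_P C H X \<xi> select i"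

abbreviation Q :: "nat \<Rightarrow> 'a \<times> 'a" where
  "Q i \<equiv> refinement_Q C H X \<xi> select i"

abbreviation q_next :: "nat \<Rightarrow> 'a" where
  "q_next i \<equiv> select (\<kappa> C (P i)) (quot_map C (P i) (Q i)) \<cdot> \<kappa> C (P i)"

lemma refinement_Suc:
  "q_bar (Suc i) = pairing C (q_bar i) (q_next i)"
  "P (Suc i) = kernel C (FArr H (q_bar (Suc i)) \<cdot> \<xi>)"
  "Q (Suc i) = kernel C (q_bar (Suc i))"
  unfolding refinement_P_def refinement_Q_def by (simp_all add: Let_def split_beta)

lemma refinement_0:
  "q_bar 0 = bang C X" "P 0 = kernel C (FArr H (bang C X) \<cdot> \<xi>)" "Q 0 = (proj1 C X X, proj2 C X X)"
  unfolding refinement_P_def refinement_Q_def by simp_all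

lemma X_obj: "X \<in> Obj C" and \<xi>_hom: "\<xi> \<in> hom C X (FObj H X)"
  using coalgebra unfolding coalgebra_def by auto

lemma H_hom: "f \<in> hom C A B \<Longrightarrow> FArr H f \<in> hom C (FObj H A) (FObj H B)"
  using is_functor unfolding is_functor_def hom_def by auto

lemma H_comp: "f \<in> hom C A B \<Longrightarrow> g \<in> hom C B D \<Longrightarrow> FArr H (g \<cdot> f) = FArr H g \<cdot> FArr H f"
  using is_functor unfolding is_functor_def hom_def by auto

lemma H_id: "A \<in> Obj C \<Longrightarrow> FArr H (Id C A) = Id C (FObj H A)"
  using is_functor unfolding is_functor_def by auto

lemma struct_hom: "f \<in> hom C X A \<Longrightarrow> FArr H f \<cdot> \<xi> \<in> hom C X (FObj H A)"
  using H_hom \<xi>_hom by blast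

lemma struct_comp:
  assumes "f \<in> hom C X A" "g \<in> hom C A B"
  shows "FArr H (g \<cdot> f) \<cdot> \<xi> = FArr H g \<cdot> (FArr H f \<cdot> \<xi>)"
  using H_comp[OF assms] comp_assoc[OF \<xi>_hom H_hom[OF assms(1)] H_hom[OF assms(2)]] by simp

text \<open>\<open>q_next i\<close> factors through \<open>\<kappa> C (P i)\<close>, which has the
  same kernel as \<open>f\<close>.\<close>

lemma ker_le_q_next:
  assumes P: "is_kernel_pair C f (P i)" "f \<in> hom C X Y" and Q: "is_kernel_pair C g (Q i)" "g \<in> hom C X Z"
    and "ker_le f g"
  obtains K where "q_next i \<in> hom C X K" "ker_le f (q_next i)"
proof -
  let ?s = "select (\<kappa> C (P i)) (quot_map C (P i) (Q i))"
  note m = quot_map_regular_epi[OF P Q assms(5)] and p = \<kappa>_kernel[OF P]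
  have "?s \<in> Arr C \<and> Dom C ?s = Cod C (\<kappa> C (P i))"
    using select_routine p(2) m homD[OF m(1)] unfolding select_routine_def quot_def by blast
  then have s: "?s \<in> hom C (quot C (P i)) (Cod C ?s)" by (auto simp: hom_def quot_def)
  show thesis
    using that[OF comp_hom[OF p(3) s]] ker_le_trans[OF P(2) p(3,4) ker_le_comp[OF p(3) s]] .
qed

text \<open>The clauses are proved together because each stage needs \<open>P i\<close> finer than
  \<open>Q i\<close> before \<open>select\<close> can be applied to form the next one.\<close>

lemma refinement_invariant:
  "\<exists>K. q_bar i \<in> hom C X K \<and> is_kernel_pair C (FArr H (q_bar i) \<cdot> \<xi>) (P i) \<and>
    is_kernel_pair C (q_bar i) (Q i) \<and> ker_le (FArr H (q_bar i) \<cdot> \<xi>) (q_bar i)"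
proof (induction i)
  case 0
  note b = bang_hom[OF X_obj] and pr = proj_hom[OF X_obj X_obj]
  \<comment> \<open>\<open>Q 0\<close> is given by the projections rather than by
    \<open>kernel\<close>. They form a kernel pair of \<open>bang C X\<close>, since any two
    parallel morphisms into the terminal object agree.\<close>
  have "is_kernel_pair C (bang C X) (proj1 C X X, proj2 C X X)"
  proof -
    have "\<exists>!h. h \<in> hom C Z (prod_obj C X X) \<and> proj1 C X X \<cdot> h = a \<and> proj2 C X X \<cdot> h = b"
      if "a \<in> hom C Z X" "b \<in> hom C Z X" for Z a b
      using product_is_product[OF X_obj X_obj] that unfolding is_product_def prod.case by blast
    then show ?thesis
      using homD[OF b] homD[OF pr(1)] pr to_terminal_unique[OF comp_hom[OF pr(1) b] comp_hom[OF pr(2) b]]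
      unfolding is_kernel_pair_def by auto
  qed
  moreover have "ker_le (FArr H (bang C X) \<cdot> \<xi>) (bang C X)"
    using to_terminal_unique comp_hom b by (intro ker_leI[OF struct_hom[OF b]]) blast
  ultimately show ?case
    using b kernel_is_kernel_pair[OF struct_hom[OF b]] unfolding refinement_0 by blast
next
  case (Suc i)
  then obtain K where q: "q_bar i \<in> hom C X K" and P: "is_kernel_pair C (FArr H (q_bar i) \<cdot> \<xi>) (P i)"
    and Q: "is_kernel_pair C (q_bar i) (Q i)" and le: "ker_le (FArr H (q_bar i) \<cdot> \<xi>) (q_bar i)"
    by blast
  obtain K' where n: "q_next i \<in> hom C X K'" "ker_le (FArr H (q_bar i) \<cdot> \<xi>) (q_next i)"
    using ker_le_q_next[OF P struct_hom[OF q] Q q le] .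
  note pq = pairing[OF q n(1), folded refinement_Suc(1)]
  have o: "K \<in> Obj C" "K' \<in> Obj C" using homD[OF q] homD[OF n(1)] by auto
  have "ker_le (FArr H (q_bar i) \<cdot> \<xi>) (q_bar (Suc i))"
    unfolding refinement_Suc(1) using ker_le_pairing[OF struct_hom[OF q] q le n] .
  \<comment> \<open>The old \<open>q_bar i\<close> is the first projection of the new one, so
    applying \<open>H\<close> shows that \<open>P (Suc i)\<close> is finer than
    \<open>P i\<close>.\<close>
  moreover have "ker_le (FArr H (q_bar (Suc i)) \<cdot> \<xi>) (FArr H (q_bar i) \<cdot> \<xi>)"
    using ker_le_comp[OF struct_hom[OF pq(1)] H_hom[OF proj_hom(1)[OF o]]]
      struct_comp[OF pq(1) proj_hom(1)[OF o]] pq(2) by simp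
  ultimately have "ker_le (FArr H (q_bar (Suc i)) \<cdot> \<xi>) (q_bar (Suc i))"
    using ker_le_trans[OF struct_hom[OF pq(1)] struct_hom[OF q]] by blast
  then show ?case
    using pq(1) kernel_is_kernel_pair[OF pq(1)] kernel_is_kernel_pair[OF struct_hom[OF pq(1)]]
    unfolding refinement_Suc(2,3) by blast
qed

lemma coalgebra_morphism_refines:
  assumes e: "coalgebra_morphism C H X \<xi> Y \<zeta> e" "regular_epi C e"
  shows "ker_le e (q_bar i)"
proof (induction i)
  have h: "e \<in> hom C X Y" using e unfolding coalgebra_morphism_def by blast
  case 0
  show ?case unfolding refinement_0
    using to_terminal_unique comp_hom bang_hom[OF X_obj] by (intro ker_leI[OF h]) blast
next
  have h: "e \<in> hom C X Y" and z: "\<zeta> \<in> hom C Y (FObj H Y)" and eq: "\<zeta> \<cdot> e = FArr H e \<cdot> \<xi>"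
    using e unfolding coalgebra_morphism_def coalgebra_def by blast+
  case (Suc i)
  obtain K where q: "q_bar i \<in> hom C X K" and P: "is_kernel_pair C (FArr H (q_bar i) \<cdot> \<xi>) (P i)"
    and Q: "is_kernel_pair C (q_bar i) (Q i)" and le: "ker_le (FArr H (q_bar i) \<cdot> \<xi>) (q_bar i)"
    using refinement_invariant by blast
  obtain K' where n: "q_next i \<in> hom C X K'" "ker_le (FArr H (q_bar i) \<cdot> \<xi>) (q_next i)"
    using ker_le_q_next[OF P struct_hom[OF q] Q q le] .
  \<comment> \<open>\<open>H\<close> need not respect containment of kernels, but it acts on a
    factorization. Regularity of \<open>e\<close> turns the induction hypothesis into one.\<close>
  obtain g where g: "g \<in> hom C Y K" "g \<cdot> e = q_bar i"
    using regular_epi_factor[OF e(2) h q Suc] .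
  have "FArr H (q_bar i) \<cdot> \<xi> = (FArr H g \<cdot> \<zeta>) \<cdot> e"
    using struct_comp[OF h g(1)] g(2) eq comp_assoc[OF h z H_hom[OF g(1)]] by simp
  then have "ker_le e (FArr H (q_bar i) \<cdot> \<xi>)"
    using ker_le_comp[OF h comp_hom[OF z H_hom[OF g(1)]]] by simp
  then have "ker_le e (q_next i)" using ker_le_trans[OF h struct_hom[OF q] _ n(2)] by blast
  then show ?case unfolding refinement_Suc using ker_le_pairing[OF h q Suc n(1)] by blast
qed

text \<open>Existence and uniqueness justify the \<open>THE\<close> at every stage \<open>i\<close>,
  whether or not \<open>P i\<close> and \<open>Q i\<close> agree. Uniqueness holds because
  \<open>\<kappa> C (P i)\<close> is epic.\<close>

lemma quot_struct:
  "quot_struct C H X \<xi> (P i) (Q i) \<in> hom C (quot C (P i)) (FObj H (quot C (Q i)))"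
  "quot_struct C H X \<xi> (P i) (Q i) \<cdot> \<kappa> C (P i) = FArr H (\<kappa> C (Q i)) \<cdot> \<xi>"
proof -
  obtain K where q: "q_bar i \<in> hom C X K" and P: "is_kernel_pair C (FArr H (q_bar i) \<cdot> \<xi>) (P i)"
    and Q: "is_kernel_pair C (q_bar i) (Q i)"
    using refinement_invariant by blast
  note p = \<kappa>_kernel[OF P struct_hom[OF q]] and k = \<kappa>_kernel[OF Q q]
  obtain m where m: "m \<in> hom C (quot C (Q i)) K" "m \<cdot> \<kappa> C (Q i) = q_bar i"
    using regular_epi_factor[OF k(2,3) q k(5)] .
  have "mono_arr C m" using image_mono[OF k(2,3) m(1)] k(4) m(2) by simp
  then have mono: "mono_arr C (FArr H m)" using preserves_monos unfolding preserves_monos_def by blast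
  note t = struct_hom[OF k(3)]
  have "ker_le (\<kappa> C (P i)) (FArr H (\<kappa> C (Q i)) \<cdot> \<xi>)"
  proof (rule ker_leI[OF p(3)])
    fix Z a b assume ab: "a \<in> hom C Z X" "b \<in> hom C Z X" "\<kappa> C (P i) \<cdot> a = \<kappa> C (P i) \<cdot> b"
    have "(FArr H (q_bar i) \<cdot> \<xi>) \<cdot> a = (FArr H (q_bar i) \<cdot> \<xi>) \<cdot> b"
      using ker_leD[OF p(5,3) ab] .
    \<comment> \<open>With \<open>q_bar i\<close> written as
      \<open>m \<cdot> \<kappa> C (Q i)\<close>, the monomorphism \<open>FArr H m\<close> comes out
      on the left and can be cancelled.\<close>
    then have "FArr H m \<cdot> ((FArr H (\<kappa> C (Q i)) \<cdot> \<xi>) \<cdot> a) = FArr H m \<cdot> ((FArr H (\<kappa> C (Q i)) \<cdot> \<xi>) \<cdot> b)"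
      using struct_comp[OF k(3) m(1)] m(2) comp_assoc[OF ab(1) t H_hom[OF m(1)]]
        comp_assoc[OF ab(2) t H_hom[OF m(1)]] by simp
    then show "(FArr H (\<kappa> C (Q i)) \<cdot> \<xi>) \<cdot> a = (FArr H (\<kappa> C (Q i)) \<cdot> \<xi>) \<cdot> b"
      using mono_arrD[OF mono H_hom[OF m(1)]] ab t by blast
  qed
  then obtain g where "g \<in> hom C (quot C (P i)) (FObj H (quot C (Q i)))"
    "g \<cdot> \<kappa> C (P i) = FArr H (\<kappa> C (Q i)) \<cdot> \<xi>"
    using regular_epi_factor[OF p(2,3) t] by blast
  then have "\<exists>!h. h \<in> hom C (quot C (P i)) (FObj H (quot C (Q i))) \<and>
      h \<cdot> \<kappa> C (P i) = FArr H (\<kappa> C (Q i)) \<cdot> \<xi>"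
    using regular_epi_epi[OF p(2,3)] by metis
  from theI'[OF this] show
    "quot_struct C H X \<xi> (P i) (Q i) \<in> hom C (quot C (P i)) (FObj H (quot C (Q i)))"
    "quot_struct C H X \<xi> (P i) (Q i) \<cdot> \<kappa> C (P i) = FArr H (\<kappa> C (Q i)) \<cdot> \<xi>"
    unfolding quot_struct_def by auto
qed

section \<open>Coalgebra quotients and simplicity\<close>

lemma coalgebra_morphism_comp:
  assumes "coalgebra_morphism C H A \<alpha> B \<beta> f" "coalgebra_morphism C H B \<beta> D \<delta> g"
  shows "coalgebra_morphism C H A \<alpha> D \<delta> (g \<cdot> f)"
proof -
  have f: "f \<in> hom C A B" and g: "g \<in> hom C B D" and co: "coalgebra C H A \<alpha>" "coalgebra C H D \<delta>"
    and a: "\<alpha> \<in> hom C A (FObj H A)" and b: "\<beta> \<in> hom C B (FObj H B)" and d: "\<delta> \<in> hom C D (FObj H D)"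
    and eq: "\<beta> \<cdot> f = FArr H f \<cdot> \<alpha>" "\<delta> \<cdot> g = FArr H g \<cdot> \<beta>"
    using assms unfolding coalgebra_morphism_def coalgebra_def by auto
  have "\<delta> \<cdot> (g \<cdot> f) = FArr H (g \<cdot> f) \<cdot> \<alpha>"
    using comp_assoc[OF f g d] comp_assoc[OF f b H_hom[OF g]] comp_assoc[OF a H_hom[OF f] H_hom[OF g]]
      H_comp[OF f g] eq by simp
  then show ?thesis using co f g unfolding coalgebra_morphism_def by blast
qed

text \<open>Since \<open>h\<close> is epic, its left inverse \<open>k\<close> is two-sided, and
  \<open>k\<close> is a coalgebra morphism because the required square commutes after precomposition
  with \<open>h\<close>.\<close>

lemma coalgebra_iso_if_split_mono:
  assumes h: "coalgebra_quotient C H A \<alpha> B \<beta> h" and k: "k \<in> hom C B A" "k \<cdot> h = Id C A"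
  shows "coalgebra_iso C H A \<alpha> B \<beta> h"
proof -
  have hh: "h \<in> hom C A B" and co: "coalgebra C H A \<alpha>" "coalgebra C H B \<beta>"
    and m: "coalgebra_morphism C H A \<alpha> B \<beta> h" and r: "regular_epi C h"
    and a: "\<alpha> \<in> hom C A (FObj H A)" and b: "\<beta> \<in> hom C B (FObj H B)"
    and eq: "\<beta> \<cdot> h = FArr H h \<cdot> \<alpha>" and o: "A \<in> Obj C" "B \<in> Obj C"
    using h unfolding coalgebra_quotient_def coalgebra_morphism_def coalgebra_def by auto
  have "(h \<cdot> k) \<cdot> h = Id C B \<cdot> h"
    using comp_assoc[OF hh k(1) hh] k(2) comp_id[OF hh] id_comp[OF hh] by simp
  then have hk: "h \<cdot> k = Id C B"
    using regular_epi_epi[OF r hh comp_hom[OF k(1) hh] id_hom[OF o(2)]] by blast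
  have "(\<alpha> \<cdot> k) \<cdot> h = (FArr H k \<cdot> \<beta>) \<cdot> h"
    using comp_assoc[OF hh k(1) a] comp_assoc[OF hh b H_hom[OF k(1)]] eq k(2) comp_id[OF a]
      comp_assoc[OF a H_hom[OF hh] H_hom[OF k(1)]] H_comp[OF hh k(1)] H_id[OF o(1)] id_comp[OF a]
    by simp
  then have "\<alpha> \<cdot> k = FArr H k \<cdot> \<beta>"
    using regular_epi_epi[OF r hh comp_hom[OF k(1) a] comp_hom[OF b H_hom[OF k(1)]]] by blast
  then have "coalgebra_morphism C H B \<beta> A \<alpha> k"
    using co k unfolding coalgebra_morphism_def by blast
  then show ?thesis using m hk k unfolding coalgebra_iso_def by blast
qed

lemma simple_if_kernel_eq:
  assumes eq: "kernel_eq C (P i) (Q i)"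
  shows "simple_coalgebra C H (quot C (Q i)) (quot_struct C H X \<xi> (P i) (Q i))"
proof -
  let ?x = "quot_struct C H X \<xi> (P i) (Q i)" and ?k = "\<kappa> C (Q i)" and ?B = "quot C (Q i)"
  obtain K where q: "q_bar i \<in> hom C X K" and P: "is_kernel_pair C (FArr H (q_bar i) \<cdot> \<xi>) (P i)"
    and Q: "is_kernel_pair C (q_bar i) (Q i)"
    using refinement_invariant by blast
  note k = \<kappa>_kernel[OF Q q]
  have \<kappa>: "\<kappa> C (P i) = ?k" using kernel_eq_\<kappa>[OF eq P struct_hom[OF q] Q q] .
  \<comment> \<open>Equality of the two chosen coequalizers identifies \<open>quot C (P i)\<close>
    with \<open>?B\<close>, so \<open>?x\<close> becomes a structure on a single object.\<close>
  then have x: "?x \<in> hom C ?B (FObj H ?B)" "?x \<cdot> ?k = FArr H ?k \<cdot> \<xi>"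
    using quot_struct[of i] unfolding quot_def by auto
  have co: "coalgebra C H ?B ?x" using x homD[OF k(3)] unfolding coalgebra_def by blast
  have km: "coalgebra_morphism C H X \<xi> ?B ?x ?k"
    using coalgebra co x(2) k(3) unfolding coalgebra_morphism_def by blast
  have "coalgebra_iso C H ?B ?x Y \<zeta> h" if h: "coalgebra_quotient C H ?B ?x Y \<zeta> h" for Y \<zeta> h
  proof -
    have hh: "h \<in> hom C ?B Y" and hm: "coalgebra_morphism C H ?B ?x Y \<zeta> h" and r: "regular_epi C h"
      using h unfolding coalgebra_quotient_def coalgebra_morphism_def by auto
    have hk: "h \<cdot> ?k \<in> hom C X Y" using hh k(3) by blast
    have re: "regular_epi C (h \<cdot> ?k)"
      using regular_epis_compose k(2) r homD[OF hh] homD[OF k(3)] unfolding regular_epis_compose_def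
      by metis
    have "ker_le (h \<cdot> ?k) (q_bar i)"
      using coalgebra_morphism_refines[OF coalgebra_morphism_comp[OF km hm] re] .
    \<comment> \<open>\<open>?k\<close> is the quotient by the kernel \<open>Q i\<close> of
      \<open>q_bar i\<close>, so it identifies all that \<open>q_bar i\<close> does.\<close>
    then have "ker_le (h \<cdot> ?k) ?k" using ker_le_trans[OF hk q _ k(4)] by blast
    then obtain g where g: "g \<in> hom C Y ?B" "g \<cdot> (h \<cdot> ?k) = ?k"
      using regular_epi_factor[OF re hk k(3)] by blast
    have "(g \<cdot> h) \<cdot> ?k = Id C ?B \<cdot> ?k"
      using g(2) comp_assoc[OF k(3) hh g(1)] id_comp[OF k(3)] by simp
    then have "g \<cdot> h = Id C ?B"
      using regular_epi_epi[OF k(2,3) comp_hom[OF hh g(1)] id_hom] homD[OF hh] by blast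
    then show ?thesis using coalgebra_iso_if_split_mono[OF h g(1)] by blast
  qed
  then show ?thesis using co unfolding simple_coalgebra_def by blast
qed

end

theorem theorem4p14:
  fixes C :: "('o, 'a) precat"
    and H :: "('o, 'a, 'o, 'a) prefunctor"
    and X :: 'o and \<xi> :: 'a
    and select :: "'a \<Rightarrow> 'a \<Rightarrow> 'a"
    and i :: nat
  defines "P \<equiv> refinement_P C H X \<xi> select i"
    and "Q \<equiv> refinement_Q C H X \<xi> select i"
  assumes "category C"
    and "finitely_complete C"
    and "has_coequalizers C"
    and "regular_epis_compose C"
    and "is_functor C C H"
    and "preserves_monos C C H"
    and "coalgebra C H X \<xi>"
    and "select_routine C select"
    and "kernel_eq C P Q"
  shows "simple_coalgebra C H (quot C Q) (quot_struct C H X \<xi> P Q)"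
proof -
  interpret refinement_algorithm C H X \<xi> select
    by unfold_locales (fact assms)+
  show ?thesis
    using simple_if_kernel_eq assms(11) unfolding P_def Q_def .
qed

end
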